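(* The Tryst Table Problem has a solution for all sufficiently large $n$.
   Context: A tryst team is a set of three players, one of whom is designated its captain. A tryst game is played by nine distinct players divided into three tryst teams. The Tryst Table Problem for $n$ players is to find a collection (schedule) of tryst games on a set of $n$ players such that (1) for every set $T$ of three players and every $x \in T$ there is exactly one game in the schedule in which $T$ is a team with captain $x$, and (2) for every set $T$ of three players there is exactly one game in the schedule in which $T$ is the set of captains of the three teams of that game. *)

theory Defs
  imports Main "HOL-Library.Disjoint_Sets"
begin

text \<open>A team is a pair of its set of players and its captain.\<close>

type_synonym 'a team = "'a set \<times> 'a"

definition tryst_team :: "'a team \<Rightarrow> bool" where
  "tryst_team t \<longleftrightarrow> card (fst t) = 3 \<and> snd t \<in> fst t"

text \<open>A game is the set of its three teams; \<^term>\<open>disjoint_family_on fst g\<close> makes the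
  player sets of distinct teams disjoint.\<close>

definition tryst_game :: "'a set \<Rightarrow> 'a team set \<Rightarrow> bool" where
  "tryst_game V g \<longleftrightarrow>
     card g = 3 \<and> (\<forall>t\<in>g. tryst_team t \<and> fst t \<subseteq> V) \<and> disjoint_family_on fst g"

lemma tryst_game_card_players:
  assumes "tryst_game V g"
  shows "card (\<Union>t\<in>g. fst t) = 9"
proof -
  have g: "card g = 3" "\<And>t. t \<in> g \<Longrightarrow> card (fst t) = 3"
    and d: "disjoint_family_on fst g"
    using assms by (auto simp: tryst_game_def tryst_team_def)
  have "finite g" using g(1) by (metis card.infinite zero_neq_numeral)
  moreover have "\<forall>t\<in>g. finite (fst t)" using g(2) by (metis card.infinite zero_neq_numeral)
  ultimately have "card (\<Union>t\<in>g. fst t) = (\<Sum>t\<in>g. card (fst t))"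
    using d by (intro card_UN_disjoint) (auto simp: disjoint_family_on_def)
  also have "\<dots> = 9" using g by simp
  finally show ?thesis .
qed

definition captains :: "'a team set \<Rightarrow> 'a set" where
  "captains g = snd ` g"

definition tryst_schedule :: "'a set \<Rightarrow> 'a team set set \<Rightarrow> bool" where
  "tryst_schedule V S \<longleftrightarrow>
     (\<forall>g\<in>S. tryst_game V g) \<and>
     (\<forall>T. T \<subseteq> V \<and> card T = 3 \<longrightarrow> (\<forall>x\<in>T. \<exists>!g. g \<in> S \<and> (T, x) \<in> g)) \<and>
     (\<forall>T. T \<subseteq> V \<and> card T = 3 \<longrightarrow> (\<exists>!g. g \<in> S \<and> captains g = T))"

definition tryst_table_solvable :: "nat \<Rightarrow> bool" where
  "tryst_table_solvable n \<longleftrightarrow> (\<exists>S. tryst_schedule {..<n} S)"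

end

theory Submission imports Defs "HOL-Combinatorics.Transposition" begin

text \<open>
  A schedule amounts to a choice, for every player \<open>x\<close>, of a permutation \<open>\<phi> x\<close> of the pairs of
  other players: the game with captains \<open>T\<close> has the teams \<open>{x} \<union> \<phi> x (T - {x})\<close> for \<open>x \<in> T\<close>.
  The only requirement left is that the three teams of a game be disjoint.  Call \<open>(x, E)\<close> a
  conflict if \<open>\<phi> x E\<close> meets \<open>E\<close> or the pair of another captain in \<open>{x} \<union> E\<close>.
  Starting from the reflections \<open>z \<mapsto> 2x - z\<close> modulo \<open>n\<close>, conflicts are removed one at a
  time by exchanging two values \<open>\<phi> a E\<close> and \<open>\<phi> a F\<close>.  Of the roughly \<open>n\<^sup>2/2\<close> choices for
  \<open>F\<close>, only \<open>O(n)\<close> are unsuitable, apart from those for which \<open>\<phi> a E\<close> meets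
  \<open>\<phi> d ({a} \<union> F - {d})\<close> for some \<open>d \<in> F\<close>.  The latter are controlled by keeping the load, the
  number of \<open>(x, E)\<close> with \<open>y \<in> E\<close> and \<open>p \<in> \<phi> x E\<close>, at most \<open>n\<^sup>2/8\<close> for all \<open>y\<close> and \<open>p\<close>.
  This invariant is cheap to maintain: the loads in each row and column sum to at most \<open>2n\<^sup>2\<close>, so
  each has only boundedly many entries at the threshold, and these can be avoided as well.
\<close>

section \<open>Pair systems, flags, loads and conflicts\<close>

definition pairs :: "'a set \<Rightarrow> 'a set set" where
  "pairs U = {E. E \<subseteq> U \<and> card E = 2}"

definition pair_system :: "'a set \<Rightarrow> ('a \<Rightarrow> 'a set \<Rightarrow> 'a set) \<Rightarrow> bool" where
  "pair_system V \<phi> \<longleftrightarrow> (\<forall>x\<in>V. bij_betw (\<phi> x) (pairs (V - {x})) (pairs (V - {x})))"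

text \<open>A flag \<open>(x, E)\<close> is the captain triple \<open>insert x E\<close> seen from
  its member \<open>x\<close>; from another member \<open>y\<close> the same triple has the pair
  \<open>insert x E - {y}\<close>.\<close>

definition flags :: "'a set \<Rightarrow> ('a \<times> 'a set) set" where
  "flags V = (SIGMA x:V. pairs (V - {x}))"

definition loads :: "'a set \<Rightarrow> ('a \<Rightarrow> 'a set \<Rightarrow> 'a set) \<Rightarrow> 'a \<Rightarrow> 'a \<Rightarrow> ('a \<times> 'a set) set" where
  "loads V \<phi> y p = {(x, E) \<in> flags V. y \<in> E \<and> p \<in> \<phi> x E}"

text \<open>In a pair system \<open>\<phi> x E\<close> never contains \<open>x\<close>, so
  \<open>E\<close> holds the only captains that the value could hit.\<close>

definition conflicts :: "'a set \<Rightarrow> ('a \<Rightarrow> 'a set \<Rightarrow> 'a set) \<Rightarrow> ('a \<times> 'a set) set" where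
  "conflicts V \<phi> =
     {(x, E) \<in> flags V. \<phi> x E \<inter> (E \<union> (\<Union>y\<in>E. \<phi> y (insert x E - {y}))) \<noteq> {}}"

lemma finite_pairs: "finite U \<Longrightarrow> finite (pairs U)"
  by (rule finite_subset[of _ "Pow U"]) (auto simp: pairs_def)

lemma finite_flags: "finite V \<Longrightarrow> finite (flags V)"
  by (simp add: flags_def finite_pairs)

lemma finite_loads: "finite V \<Longrightarrow> finite (loads V \<phi> y p)"
  by (rule finite_subset[OF _ finite_flags]) (auto simp: loads_def)

lemma pairsD: "E \<in> pairs U \<Longrightarrow> E \<subseteq> U" "E \<in> pairs U \<Longrightarrow> card E = 2"
  "E \<in> pairs U \<Longrightarrow> finite E"
  by (auto simp: pairs_def intro: card_ge_0_finite)

lemma pair_system_mem: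
  assumes "pair_system V \<phi>" "x \<in> V" "E \<in> pairs (V - {x})"
  shows "\<phi> x E \<in> pairs (V - {x})"
  using assms by (auto simp: pair_system_def bij_betw_def)

lemma pair_exchange:
  assumes "a \<in> V" "E \<in> pairs (V - {a})" "y \<in> E"
  shows "y \<in> V" "insert a E - {y} \<in> pairs (V - {y})"
proof -
  show "y \<in> V" using assms by (auto simp: pairs_def)
  have "a \<notin> E" using assms by (auto simp: pairs_def)
  then have "card (insert a E - {y}) = 2"
    using assms pairsD[OF assms(2)] by simp
  then show "insert a E - {y} \<in> pairs (V - {y})"
    using assms by (auto simp: pairs_def)
qed

section \<open>Counting pairs, flags and loads\<close>

text \<open>Such a pair is \<open>{s, u}\<close> with \<open>s\<close> in \<open>S\<close>. For
  bounded \<open>S\<close> this is only linear in \<open>card U\<close>, against a quadratic number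
  of pairs.\<close>

lemma card_pairs_meeting_le:
  assumes "finite U" "finite S"
  shows "card {E \<in> pairs U. E \<inter> S \<noteq> {}} \<le> card S * card U"
proof -
  have "{E \<in> pairs U. E \<inter> S \<noteq> {}} \<subseteq> (\<lambda>(s, u). {s, u}) ` (S \<times> U)"
  proof
    fix E assume "E \<in> {E \<in> pairs U. E \<inter> S \<noteq> {}}"
    then obtain s where s: "s \<in> E" "s \<in> S" and E: "E \<subseteq> U" "card E = 2"
      by (auto simp: pairs_def)
    then obtain u where "E = {s, u}"
      by (metis card_2_iff doubleton_eq_iff insert_iff singletonD)
    then show "E \<in> (\<lambda>(s, u). {s, u}) ` (S \<times> U)" using s E by auto
  qed
  then have "card {E \<in> pairs U. E \<inter> S \<noteq> {}} \<le> card ((\<lambda>(s, u). {s, u}) ` (S \<times> U))"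
    using assms by (intro card_mono) auto
  also have "\<dots> \<le> card (S \<times> U)" using assms by (intro card_image_le) auto
  finally show ?thesis by (simp add: card_cartesian_product)
qed

lemma card_pairs_preimage_meeting_le:
  assumes "finite U" "finite S" "bij_betw f (pairs U) (pairs U)"
  shows "card {E \<in> pairs U. f E \<inter> S \<noteq> {}} \<le> card S * card U"
proof -
  have "card {E \<in> pairs U. f E \<inter> S \<noteq> {}} \<le> card {E \<in> pairs U. E \<inter> S \<noteq> {}}"
    using assms by (intro card_inj_on_le[of f])
      (auto simp: bij_betw_def finite_pairs intro: inj_on_subset)
  also have "\<dots> \<le> card S * card U" using assms by (intro card_pairs_meeting_le)
  finally show ?thesis .
qed

lemma card_flags_le:
  assumes "finite V" "\<And>x. x \<in> V \<Longrightarrow> card {E \<in> pairs (V - {x}). P x E} \<le> card V"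
  shows "card {(x, E) \<in> flags V. P x E} \<le> card V * card V"
proof -
  have "{(x, E) \<in> flags V. P x E} = (SIGMA x:V. {E \<in> pairs (V - {x}). P x E})"
    by (auto simp: flags_def)
  then have "card {(x, E) \<in> flags V. P x E} = (\<Sum>x\<in>V. card {E \<in> pairs (V - {x}). P x E})"
    using assms(1) by (simp add: finite_pairs)
  also have "\<dots> \<le> card V * card V"
    using sum_bounded_above[of V "\<lambda>x. card {E \<in> pairs (V - {x}). P x E}" "card V"] assms(2)
    by simp
  finally show ?thesis .
qed

lemma card_flags_containing_le:
  assumes "finite V"
  shows "card {(x, E) \<in> flags V. y \<in> E} \<le> card V * card V"
proof (rule card_flags_le[OF assms])
  fix x assume "x \<in> V"
  have "card {E \<in> pairs (V - {x}). E \<inter> {y} \<noteq> {}} \<le> card {y} * card (V - {x})"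
    using assms by (intro card_pairs_meeting_le) auto
  also have "\<dots> \<le> card V" using assms by (simp add: card_mono)
  finally show "card {E \<in> pairs (V - {x}). y \<in> E} \<le> card V" by simp
qed

lemma card_flags_image_containing_le:
  assumes "finite V" "pair_system V \<phi>"
  shows "card {(x, E) \<in> flags V. p \<in> \<phi> x E} \<le> card V * card V"
proof (rule card_flags_le[OF assms(1)])
  fix x assume x: "x \<in> V"
  have "card {E \<in> pairs (V - {x}). \<phi> x E \<inter> {p} \<noteq> {}} \<le> card {p} * card (V - {x})"
    using assms x by (intro card_pairs_preimage_meeting_le) (auto simp: pair_system_def)
  also have "\<dots> \<le> card V" using assms by (simp add: card_mono)
  finally show "card {E \<in> pairs (V - {x}). p \<in> \<phi> x E} \<le> card V" by simp
qed

text \<open>Double counting of the incidences between points \<open>p\<close> and sets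
  \<open>h t\<close>.\<close>

lemma sum_card_mem_le:
  assumes "finite V" "finite A" "\<And>t. t \<in> A \<Longrightarrow> finite (h t) \<and> card (h t) \<le> k"
  shows "(\<Sum>p\<in>V. card {t \<in> A. p \<in> h t}) \<le> k * card A"
proof -
  have "(\<Sum>p\<in>V. card {t \<in> A. p \<in> h t}) = (\<Sum>t\<in>A. card {p \<in> V. p \<in> h t})"
    using sum.swap_restrict[OF assms(1,2), of "\<lambda>_ _. 1::nat" "\<lambda>p t. p \<in> h t"] by simp
  also have "\<dots> \<le> (\<Sum>t\<in>A. k)"
  proof (rule sum_mono)
    fix t assume t: "t \<in> A"
    have "card {p \<in> V. p \<in> h t} \<le> card (h t)" using assms(3)[OF t] by (intro card_mono) auto
    then show "card {p \<in> V. p \<in> h t} \<le> k" using assms(3)[OF t] by simp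
  qed
  finally show ?thesis by (simp add: mult.commute)
qed

text \<open>At most \<open>card V * card V\<close> flags have \<open>y\<close> in their pair, and
  each is counted for at most the two points \<open>p\<close> of its value.\<close>

lemma sum_loads_row_le:
  assumes "finite V" "pair_system V \<phi>"
  shows "(\<Sum>p\<in>V. card (loads V \<phi> y p)) \<le> 2 * (card V * card V)"
proof -
  let ?A = "{(x, E) \<in> flags V. y \<in> E}"
  have "(\<Sum>p\<in>V. card (loads V \<phi> y p)) = (\<Sum>p\<in>V. card {t \<in> ?A. p \<in> (\<lambda>(x, E). \<phi> x E) t})"
    by (rule sum.cong, simp, rule arg_cong[where f = card]) (auto simp: loads_def)
  also have "\<dots> \<le> 2 * card ?A"
  proof (rule sum_card_mem_le[OF assms(1)])
    show "finite ?A" by (rule finite_subset[OF _ finite_flags[OF assms(1)]]) auto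
    fix t assume "t \<in> ?A"
    then obtain x E where "t = (x, E)" "x \<in> V" "E \<in> pairs (V - {x})"
      by (auto simp: flags_def)
    then show "finite ((\<lambda>(x, E). \<phi> x E) t) \<and> card ((\<lambda>(x, E). \<phi> x E) t) \<le> 2"
      using pairsD[OF pair_system_mem[OF assms(2)]] by auto
  qed
  also have "\<dots> \<le> 2 * (card V * card V)" using card_flags_containing_le[OF assms(1)] by simp
  finally show ?thesis .
qed

lemma sum_loads_column_le:
  assumes "finite V" "pair_system V \<phi>"
  shows "(\<Sum>y\<in>V. card (loads V \<phi> y p)) \<le> 2 * (card V * card V)"
proof -
  let ?A = "{(x, E) \<in> flags V. p \<in> \<phi> x E}"
  have "(\<Sum>y\<in>V. card (loads V \<phi> y p)) = (\<Sum>y\<in>V. card {t \<in> ?A. y \<in> snd t})"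
    by (rule sum.cong, simp, rule arg_cong[where f = card]) (auto simp: loads_def)
  also have "\<dots> \<le> 2 * card ?A"
  proof (rule sum_card_mem_le[OF assms(1)])
    show "finite ?A" by (rule finite_subset[OF _ finite_flags[OF assms(1)]]) auto
    show "finite (snd t) \<and> card (snd t) \<le> 2" if "t \<in> ?A" for t
      using that by (auto simp: flags_def dest: pairsD)
  qed
  also have "\<dots> \<le> 2 * (card V * card V)"
    using card_flags_image_containing_le[OF assms] by simp
  finally show ?thesis .
qed

text \<open>Pigeonhole: \<open>Suc m\<close> values of size at least \<open>K\<close> would already
  sum to more than \<open>M\<close>.\<close>

lemma card_large_values_le:
  fixes f :: "'a \<Rightarrow> nat"
  assumes "finite V" "(\<Sum>v\<in>V. f v) \<le> M" "M < Suc m * K"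
  shows "card {v \<in> V. K \<le> f v} \<le> m"
proof -
  have "card {v \<in> V. K \<le> f v} * K \<le> (\<Sum>v\<in>{v \<in> V. K \<le> f v}. f v)"
    using sum_bounded_below[of "{v \<in> V. K \<le> f v}" K f] by simp
  also have "\<dots> \<le> (\<Sum>v\<in>V. f v)" using assms(1) by (intro sum_mono2) auto
  finally have "card {v \<in> V. K \<le> f v} * K < Suc m * K" using assms by linarith
  then show ?thesis by (metis less_Suc_eq_le mult_less_cancel2)
qed

lemma card_UN_pair_le:
  assumes "card E = 2" "\<And>y. y \<in> E \<Longrightarrow> card (f y) \<le> k"
  shows "card (\<Union>y\<in>E. f y) \<le> 2 * k"
proof -
  have "finite E" using assms(1) by (simp add: card_ge_0_finite)
  then have "card (\<Union>y\<in>E. f y) \<le> (\<Sum>y\<in>E. card (f y))" by (rule card_UN_le)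
  also have "\<dots> \<le> 2 * k" using sum_bounded_above[of E "\<lambda>y. card (f y)" k] assms by simp
  finally show ?thesis .
qed

lemma card_pairs_twice:
  assumes "finite U"
  shows "2 * card (pairs U) = card U * (card U - 1)"
proof -
  have "even (card U * (card U - 1))" by (cases "card U") auto
  then show ?thesis using n_subsets[OF assms, of 2] by (simp add: pairs_def choose_two)
qed

section \<open>Finding an exchange partner\<close>

text \<open>The unsuitable \<open>F\<close> are those meeting \<open>R\<close>, those whose value
  meets \<open>S\<close>, and those in \<open>B\<close>: at most
  \<open>36 * n + 38 * n + 2 * K\<close> pairs. The lower bound on \<open>K\<close> keeps
  \<open>R\<close> and \<open>S\<close> bounded; the upper bound keeps \<open>2 * K\<close> below
  about half of all pairs.\<close>

lemma exchange_partner_exists: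
  assumes V: "finite V" and \<phi>: "pair_system V \<phi>"
    and K: "\<And>y p. card (loads V \<phi> y p) \<le> K" "2 * (card V * card V) < 17 * K"
      "8 * K \<le> card V * card V"
    and n: "card V \<ge> 400"
    and a: "a \<in> V" and E: "E \<in> pairs (V - {a})"
  obtains F where "F \<in> pairs (V - {a})" "E \<inter> F = {}" "\<phi> a F \<inter> E = {}" "\<phi> a E \<inter> F = {}"
    "\<And>y. y \<in> E \<Longrightarrow> \<phi> a F \<inter> \<phi> y (insert a E - {y}) = {}"
    "\<And>y. y \<in> F \<Longrightarrow> \<phi> a E \<inter> \<phi> y (insert a F - {y}) = {}"
    "\<And>y p. y \<in> E \<Longrightarrow> p \<in> \<phi> a F \<Longrightarrow> card (loads V \<phi> y p) < K"
    "\<And>y p. y \<in> F \<Longrightarrow> p \<in> \<phi> a E \<Longrightarrow> card (loads V \<phi> y p) < K"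
proof -
  define n where "n = card V"
  define U where "U = V - {a}"
  define P where "P = \<phi> a E"
  \<comment> \<open>Points that the new value \<open>\<phi> a F\<close> of \<open>E\<close> must
    avoid: the captains in \<open>E\<close>, the values of these captains, and every
    \<open>p\<close> whose load with some \<open>y\<close> in \<open>E\<close> is saturated.\<close>
  define S where "S = E \<union> (\<Union>y\<in>E. \<phi> y (insert a E - {y}))
    \<union> (\<Union>y\<in>E. {p \<in> V. K \<le> card (loads V \<phi> y p)})"
  \<comment> \<open>Points that \<open>F\<close> must avoid, since \<open>F\<close> receives the
    value \<open>P\<close>.\<close>
  define R where "R = E \<union> P \<union> (\<Union>p\<in>P. {y \<in> V. K \<le> card (loads V \<phi> y p)})"
  \<comment> \<open>If \<open>P\<close> meets the value of some \<open>y\<close> in \<open>F\<close>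
    at \<open>p\<close>, then the flag \<open>(y, G)\<close> with
    \<open>G = insert a F - {y}\<close> is counted in the load of \<open>a\<close> and
    \<open>p\<close>, and \<open>F\<close> is recovered from it as
    \<open>insert y (G - {a})\<close>.\<close>
  define B where "B = (\<lambda>(x, G). insert x (G - {a})) ` (\<Union>p\<in>P. loads V \<phi> a p)"
  have U: "finite U" "card U = n - 1" using V a by (auto simp: U_def n_def)
  have EU: "E \<in> pairs U" using E by (simp add: U_def)
  have bij: "bij_betw (\<phi> a) (pairs U) (pairs U)" using \<phi> a by (simp add: pair_system_def U_def)
  have P: "P \<in> pairs U" using pair_system_mem[OF \<phi> a E] by (simp add: P_def U_def)
  have inner: "\<phi> y (insert a E - {y}) \<in> pairs (V - {y})" if "y \<in> E" for y
    using pair_exchange[OF a E that] by (intro pair_system_mem[OF \<phi>])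
  \<comment> \<open>Seventeen saturated entries in a row would sum to at least
    \<open>17 * K\<close>, above the bound on the row sum; likewise for columns.\<close>
  have row: "card {p \<in> V. K \<le> card (loads V \<phi> y p)} \<le> 16" for y
    by (rule card_large_values_le[OF V sum_loads_row_le[OF V \<phi>]]) (use K(2) in simp)
  have col: "card {y \<in> V. K \<le> card (loads V \<phi> y p)} \<le> 16" for p
    by (rule card_large_values_le[OF V sum_loads_column_le[OF V \<phi>]]) (use K(2) in simp)
  have "card S \<le> card E + card (\<Union>y\<in>E. \<phi> y (insert a E - {y}))
      + card (\<Union>y\<in>E. {p \<in> V. K \<le> card (loads V \<phi> y p)})"
    unfolding S_def by (meson add_le_mono1 card_Un_le order_trans)
  also have "\<dots> \<le> 2 + 2 * 2 + 2 * 16"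
    using pairsD[OF EU] pairsD[OF inner] row by (intro add_mono card_UN_pair_le) auto
  finally have S: "card S \<le> 38" by simp
  have "card R \<le> card E + card P + card (\<Union>p\<in>P. {y \<in> V. K \<le> card (loads V \<phi> y p)})"
    unfolding R_def by (meson add_le_mono1 card_Un_le order_trans)
  also have "\<dots> \<le> 2 + 2 + 2 * 16"
    using pairsD[OF EU] pairsD[OF P] col by (intro add_mono card_UN_pair_le) auto
  finally have R: "card R \<le> 36" by simp
  have finS: "finite S" and finR: "finite R"
    using V pairsD[OF EU] pairsD[OF P] pairsD[OF inner] by (auto simp: S_def R_def)
  have finL: "finite (\<Union>p\<in>P. loads V \<phi> a p)"
    using pairsD[OF P] V by (auto simp: finite_loads)
  have finB: "finite B" using finL by (simp add: B_def)
  have "card B \<le> card (\<Union>p\<in>P. loads V \<phi> a p)"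
    unfolding B_def using finL by (rule card_image_le)
  also have "\<dots> \<le> 2 * K" using pairsD[OF P] K(1) by (intro card_UN_pair_le)
  finally have B: "card B \<le> 2 * K" .
  let ?X = "{F \<in> pairs U. F \<inter> R \<noteq> {}}" and ?Y = "{F \<in> pairs U. \<phi> a F \<inter> S \<noteq> {}}"
  have "card ?X \<le> card R * card U" using U finR by (intro card_pairs_meeting_le)
  also have "\<dots> \<le> 36 * n" using R U by (intro mult_mono) auto
  finally have X: "card ?X \<le> 36 * n" .
  have "card ?Y \<le> card S * card U"
    using U finS bij by (intro card_pairs_preimage_meeting_le)
  also have "\<dots> \<le> 38 * n" using S U by (intro mult_mono) auto
  finally have Y: "card ?Y \<le> 38 * n" .
  have "card (?X \<union> ?Y \<union> B) \<le> card ?X + card ?Y + card B"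
    by (meson add_le_mono1 card_Un_le order_trans)
  also have "\<dots> \<le> 74 * n + 2 * K" using X Y B by simp
  also have "\<dots> < card (pairs U)"
  proof -
    \<comment> \<open>The substitution removes truncated subtraction. With
      \<open>8 * K \<le> n * n\<close> it suffices that n^2 + 4 > 302 n, which holds from 400
      on.\<close>
    obtain m where m: "n = 400 + m" using n by (auto simp: n_def le_iff_add)
    have "2 * card (pairs U) = (399 + m) * (398 + m)"
      using card_pairs_twice[OF U(1)] U(2) m by (simp add: algebra_simps)
    moreover have "8 * K \<le> (400 + m) * (400 + m)" using K(3) m by (simp add: n_def)
    ultimately show ?thesis using m by (simp add: algebra_simps)
  qed
  finally have "card (?X \<union> ?Y \<union> B) < card (pairs U)" .
  then have "\<not> pairs U \<subseteq> ?X \<union> ?Y \<union> B"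
    using card_mono[of "?X \<union> ?Y \<union> B" "pairs U"] finite_pairs[OF U(1)] finB by auto
  then obtain F where F: "F \<in> pairs U" "F \<inter> R = {}" "\<phi> a F \<inter> S = {}" "F \<notin> B" by blast
  have QU: "\<phi> a F \<in> pairs U" using bij F(1) by (auto simp: bij_betw_def)
  show thesis
  proof (rule that[of F])
    show "F \<in> pairs (V - {a})" using F by (simp add: U_def)
    show "E \<inter> F = {}" "\<phi> a E \<inter> F = {}" using F(2) by (auto simp: R_def P_def)
    show "\<phi> a F \<inter> E = {}" using F(3) by (auto simp: S_def)
    show "\<phi> a F \<inter> \<phi> y (insert a E - {y}) = {}" if "y \<in> E" for y
      using F(3) that by (auto simp: S_def)
    show "card (loads V \<phi> y p) < K" if "y \<in> E" "p \<in> \<phi> a F" for y p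
    proof -
      have "p \<in> V" using that(2) QU by (auto simp: pairs_def U_def)
      then show ?thesis using F(3) that by (auto simp: S_def not_le[symmetric])
    qed
    show "card (loads V \<phi> y p) < K" if "y \<in> F" "p \<in> \<phi> a E" for y p
    proof -
      have "y \<in> V" using that(1) F(1) by (auto simp: pairs_def U_def)
      then show ?thesis using F(2) that by (auto simp: R_def P_def not_le[symmetric])
    qed
    show "\<phi> a E \<inter> \<phi> y (insert a F - {y}) = {}" if y: "y \<in> F" for y
    proof (rule ccontr)
      assume "\<phi> a E \<inter> \<phi> y (insert a F - {y}) \<noteq> {}"
      then obtain p where p: "p \<in> P" "p \<in> \<phi> y (insert a F - {y})" by (auto simp: P_def)
      have aF: "a \<notin> F" using F(1) by (auto simp: pairs_def U_def)
      have "(y, insert a F - {y}) \<in> loads V \<phi> a p"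
        using pair_exchange[OF a _ y] F(1) y p aF by (auto simp: loads_def flags_def U_def)
      moreover have "insert y (insert a F - {y} - {a}) = F" using y aF by auto
      ultimately have "F \<in> B"
        using p(1) unfolding B_def by (intro image_eqI[of _ _ "(y, insert a F - {y})"]) auto
      then show False using F(4) by simp
    qed
  qed
qed

section \<open>Effect of an exchange on loads and conflicts\<close>

definition exchange :: "('a \<Rightarrow> 'a set \<Rightarrow> 'a set) \<Rightarrow> 'a \<Rightarrow> 'a set \<Rightarrow> 'a set \<Rightarrow> 'a \<Rightarrow> 'a set \<Rightarrow> 'a set"
  where "exchange \<phi> a E F = \<phi>(a := (\<phi> a)(E := \<phi> a F, F := \<phi> a E))"

lemma pair_system_exchange:
  assumes "pair_system V \<phi>" "E \<in> pairs (V - {a})" "F \<in> pairs (V - {a})"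
  shows "pair_system V (exchange \<phi> a E F)"
proof -
  \<comment> \<open>Swapping two values is precomposition with a transposition, so bijectivity
    persists.\<close>
  have "(\<phi> a)(E := \<phi> a F, F := \<phi> a E) = \<phi> a \<circ> transpose E F"
    by (auto simp: fun_eq_iff transpose_def)
  moreover have "bij_betw (\<phi> a \<circ> transpose E F) (pairs (V - {a})) (pairs (V - {a}))" if "a \<in> V"
  proof (rule bij_betw_trans)
    show "bij_betw (transpose E F) (pairs (V - {a})) (pairs (V - {a}))"
      using assms(2,3) by (simp add: bij_betw_def transpose_image_eq)
    show "bij_betw (\<phi> a) (pairs (V - {a})) (pairs (V - {a}))"
      using assms(1) that by (simp add: pair_system_def)
  qed
  ultimately have "bij_betw ((\<phi> a)(E := \<phi> a F, F := \<phi> a E)) (pairs (V - {a})) (pairs (V - {a}))"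
    if "a \<in> V" using that by simp
  then show ?thesis using assms(1) by (auto simp: pair_system_def exchange_def)
qed

text \<open>Only \<open>(a, E)\<close> and \<open>(a, F)\<close> can enter a load. Since
  \<open>y\<close> lies in at most one of the disjoint \<open>E\<close> and \<open>F\<close>, the
  load grows by at most one, and the last two hypotheses leave room for that.\<close>

lemma card_loads_exchange_le:
  assumes "finite V" "E \<inter> F = {}" "card (loads V \<phi> y p) \<le> K"
    and "y \<in> E \<Longrightarrow> p \<in> \<phi> a F \<Longrightarrow> card (loads V \<phi> y p) < K"
    and "y \<in> F \<Longrightarrow> p \<in> \<phi> a E \<Longrightarrow> card (loads V \<phi> y p) < K"
  shows "card (loads V (exchange \<phi> a E F) y p) \<le> K"
proof (cases "y \<in> E \<and> p \<in> \<phi> a F \<or> y \<in> F \<and> p \<in> \<phi> a E")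
  case True
  define G where "G = (if y \<in> E then E else F)"
  have "loads V (exchange \<phi> a E F) y p \<subseteq> insert (a, G) (loads V \<phi> y p)"
    using assms(2) by (auto simp: loads_def exchange_def G_def split: if_splits)
  then have "card (loads V (exchange \<phi> a E F) y p) \<le> card (insert (a, G) (loads V \<phi> y p))"
    using assms(1) by (intro card_mono) (auto simp: finite_loads)
  also have "\<dots> \<le> Suc (card (loads V \<phi> y p))" by (rule card_insert_le_m1) auto
  also have "\<dots> \<le> K" using True assms(4,5) by auto
  finally show ?thesis .
next
  case False
  then have "loads V (exchange \<phi> a E F) y p \<subseteq> loads V \<phi> y p"
    by (auto simp: loads_def exchange_def split: if_splits)
  then have "card (loads V (exchange \<phi> a E F) y p) \<le> card (loads V \<phi> y p)"
    using assms(1) by (intro card_mono) (auto simp: finite_loads)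
  then show ?thesis using assms(3) by simp
qed

text \<open>Only the triples \<open>insert a E\<close> and \<open>insert a F\<close> are affected.
  The hypotheses make \<open>(a, E)\<close> and \<open>(a, F)\<close> free of conflict and prevent
  the new values at \<open>a\<close> from creating a conflict for the other captains.\<close>

lemma conflicts_exchange:
  assumes E: "E \<in> pairs (V - {a})"
    and EF: "E \<inter> F = {}" "\<phi> a F \<inter> E = {}" "\<phi> a E \<inter> F = {}"
      "\<And>y. y \<in> E \<Longrightarrow> \<phi> a F \<inter> \<phi> y (insert a E - {y}) = {}"
      "\<And>y. y \<in> F \<Longrightarrow> \<phi> a E \<inter> \<phi> y (insert a F - {y}) = {}"
  shows "conflicts V (exchange \<phi> a E F) \<subseteq> conflicts V \<phi> - {(a, E)}"
proof
  define \<psi> where "\<psi> = exchange \<phi> a E F"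
  have "E \<noteq> F" using EF(1) pairsD(2)[OF E] by auto
  then have \<psi>: "\<psi> a E = \<phi> a F" "\<psi> a F = \<phi> a E" "\<And>G. G \<noteq> E \<Longrightarrow> G \<noteq> F \<Longrightarrow> \<psi> a G = \<phi> a G"
    "\<And>y. y \<noteq> a \<Longrightarrow> \<psi> y = \<phi> y"
    by (auto simp: \<psi>_def exchange_def)
  fix t assume "t \<in> conflicts V (exchange \<phi> a E F)"
  then obtain x G where t: "t = (x, G)" "(x, G) \<in> flags V"
    and c: "\<psi> x G \<inter> (G \<union> (\<Union>y\<in>G. \<psi> y (insert x G - {y}))) \<noteq> {}"
    by (auto simp: conflicts_def \<psi>_def)
  have xG: "x \<notin> G" using t(2) by (auto simp: flags_def pairs_def)
  show "t \<in> conflicts V \<phi> - {(a, E)}"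
  proof (cases "x = a")
    case True
    have other: "\<psi> y = \<phi> y" if "y \<in> G" for y using that xG True \<psi>(4)[of y] by blast
    then have c': "\<psi> a G \<inter> (G \<union> (\<Union>y\<in>G. \<phi> y (insert a G - {y}))) \<noteq> {}"
      using c True by simp
    have "G \<noteq> E"
    proof
      assume "G = E"
      then show False using c' \<psi>(1) EF(2,4) by auto
    qed
    moreover have "G \<noteq> F"
    proof
      assume "G = F"
      then show False using c' \<psi>(2) EF(3,5) by auto
    qed
    ultimately show ?thesis using c' \<psi>(3) t True by (auto simp: conflicts_def)
  next
    case False
    have "\<phi> x G \<inter> (G \<union> (\<Union>y\<in>G. \<phi> y (insert x G - {y}))) \<noteq> {}"
    proof
      \<comment> \<open>A conflict that is new at a captain \<open>x\<close> other than
        \<open>a\<close> must come from a changed value of \<open>a\<close>, so the triple seen from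
        \<open>a\<close> has the pair \<open>E\<close> or \<open>F\<close>.\<close>
      assume clean: "\<phi> x G \<inter> (G \<union> (\<Union>y\<in>G. \<phi> y (insert x G - {y}))) = {}"
      then obtain y where y: "y \<in> G" "\<phi> x G \<inter> \<psi> y (insert x G - {y}) \<noteq> {}"
        using c False \<psi>(4) by auto
      have ya: "y = a"
      proof (rule ccontr)
        assume "y \<noteq> a"
        then have "\<phi> x G \<inter> \<phi> y (insert x G - {y}) \<noteq> {}" using y(2) \<psi>(4) by simp
        then show False using clean y(1) by auto
      qed
      define H where "H = insert x G - {a}"
      have G: "G = insert a H - {x}" and x: "x \<in> H" using y ya xG False by (auto simp: H_def)
      have m: "\<phi> x (insert a H - {x}) \<inter> \<psi> a H \<noteq> {}"
        using y(2) unfolding ya H_def[symmetric] G[symmetric] .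
      consider "H = E" | "H = F" | "H \<noteq> E" "H \<noteq> F" by blast
      then show False
      proof cases
        case 1
        then show False using m \<psi>(1) EF(4)[of x] x by auto
      next
        case 2
        then show False using m \<psi>(2) EF(5)[of x] x by auto
      next
        case 3
        then show False using y ya clean \<psi>(3) by (auto simp: H_def)
      qed
    qed
    then show ?thesis using t False by (auto simp: conflicts_def)
  qed
qed

text \<open>Induction on the number of conflicts, with the load bound \<open>K\<close> as an
  invariant that every exchange preserves.\<close>

lemma conflict_free_exists:
  assumes V: "finite V" and n: "card V \<ge> 400"
    and K: "2 * (card V * card V) < 17 * K" "8 * K \<le> card V * card V"
    and "pair_system V \<phi>" "\<And>y p. card (loads V \<phi> y p) \<le> K"
  shows "\<exists>\<psi>. pair_system V \<psi> \<and> conflicts V \<psi> = {}"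
  using assms(5,6)
proof (induction "card (conflicts V \<phi>)" arbitrary: \<phi> rule: less_induct)
  case less
  show ?case
  proof (cases "conflicts V \<phi> = {}")
    case True
    then show ?thesis using less.prems by blast
  next
    case False
    then obtain a E where c: "(a, E) \<in> conflicts V \<phi>" by auto
    then have a: "a \<in> V" and E: "E \<in> pairs (V - {a})" by (auto simp: conflicts_def flags_def)
    obtain F where F: "F \<in> pairs (V - {a})" "E \<inter> F = {}" "\<phi> a F \<inter> E = {}" "\<phi> a E \<inter> F = {}"
      "\<And>y. y \<in> E \<Longrightarrow> \<phi> a F \<inter> \<phi> y (insert a E - {y}) = {}"
      "\<And>y. y \<in> F \<Longrightarrow> \<phi> a E \<inter> \<phi> y (insert a F - {y}) = {}"
      "\<And>y p. y \<in> E \<Longrightarrow> p \<in> \<phi> a F \<Longrightarrow> card (loads V \<phi> y p) < K"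
      "\<And>y p. y \<in> F \<Longrightarrow> p \<in> \<phi> a E \<Longrightarrow> card (loads V \<phi> y p) < K"
      using exchange_partner_exists[OF V less.prems K n a E] by metis
    have "finite (conflicts V \<phi>)"
      by (rule finite_subset[OF _ finite_flags[OF V]]) (auto simp: conflicts_def)
    moreover have "conflicts V (exchange \<phi> a E F) \<subset> conflicts V \<phi>"
      using conflicts_exchange[OF E F(2-6)] c by auto
    ultimately have "card (conflicts V (exchange \<phi> a E F)) < card (conflicts V \<phi>)"
      by (rule psubset_card_mono)
    moreover have "pair_system V (exchange \<phi> a E F)"
      using less.prems(1) E F(1) by (rule pair_system_exchange)
    moreover have "card (loads V (exchange \<phi> a E F) y p) \<le> K" for y p
      using V F(2) less.prems(2) F(7,8) by (rule card_loads_exchange_le)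
    ultimately show ?thesis by (rule less.hyps)
  qed
qed

section \<open>The initial pair system: reflections modulo n\<close>

text \<open>The residue of \<open>2 * x - y\<close>; adding \<open>n - y\<close> stays within the
  naturals for \<open>y < n\<close>. For given \<open>y\<close> and image few centres
  \<open>x\<close> are possible, which makes the initial loads linear in \<open>n\<close>.\<close>

definition reflect :: "nat \<Rightarrow> nat \<Rightarrow> nat \<Rightarrow> nat" where
  "reflect n x y = (2 * x + (n - y)) mod n"

lemma reflect_less: "0 < n \<Longrightarrow> reflect n x y < n"
  by (simp add: reflect_def)

lemma reflect_self: "x < n \<Longrightarrow> reflect n x x = x"
  by (simp add: reflect_def)

lemma reflect_cases:
  assumes "x < n" "y < n" "reflect n x y = p"
  shows "2 * x + n = p + y \<or> 2 * x = p + y \<or> 2 * x = p + y + n"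
proof -
  define q where "q = (2 * x + (n - y)) div n"
  have eq: "2 * x + (n - y) = n * q + p"
    using assms(3) unfolding q_def reflect_def by (metis mult_div_mod_eq)
  have "2 * x + (n - y) < n * 3" using assms by auto
  \<comment> \<open>The quotients 0, 1 and 2 yield the three alternatives in this order.\<close>
  then have "q < 3" unfolding q_def by (simp add: less_mult_imp_div_less mult.commute)
  then have "q = 0 \<or> q = 1 \<or> q = 2" by auto
  then show ?thesis using eq assms by auto
qed

lemma reflect_involution:
  assumes "x < n" "y < n"
  shows "reflect n x (reflect n x y) = y"
proof -
  define p where "p = reflect n x y"
  have p: "p < n" using assms by (simp add: p_def reflect_less)
  consider "2 * x + n = p + y" | "2 * x = p + y" | "2 * x = p + y + n"
    using reflect_cases[OF assms p_def[symmetric]] by auto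
  then have "(2 * x + (n - p)) mod n = y"
  proof cases
    case 1
    then have "2 * x + (n - p) = y" using p by simp
    then show ?thesis using assms by simp
  next
    case 2
    then have "2 * x + (n - p) = y + n" using p by simp
    then show ?thesis using assms by simp
  next
    case 3
    then have "2 * x + (n - p) = y + n + n" using p by simp
    then show ?thesis using assms by simp
  qed
  then show ?thesis by (simp add: p_def reflect_def)
qed

lemma bij_betw_reflect:
  assumes "x < n"
  shows "bij_betw (reflect n x) ({..<n} - {x}) ({..<n} - {x})"
proof (rule bij_betw_byWitness[where f' = "reflect n x"])
  have "reflect n x y \<in> {..<n} - {x}" if "y \<in> {..<n} - {x}" for y
  proof -
    have "reflect n x y \<noteq> x"
      using reflect_involution[OF assms, of y] reflect_self[OF assms] that by auto
    then show ?thesis using reflect_less[of n x y] assms by simp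
  qed
  then have "reflect n x ` ({..<n} - {x}) \<subseteq> {..<n} - {x}" by (rule image_subsetI)
  \<comment> \<open>The two inclusions coincide because the witness for the inverse is the
    reflection itself.\<close>
  then show "reflect n x ` ({..<n} - {x}) \<subseteq> {..<n} - {x}"
    "reflect n x ` ({..<n} - {x}) \<subseteq> {..<n} - {x}" by simp_all
qed (use reflect_involution[OF assms] in auto)

lemma bij_betw_image_pairs:
  assumes "bij_betw f U U"
  shows "bij_betw ((`) f) (pairs U) (pairs U)"
proof -
  have "bij_betw ((`) f) (Pow U) (Pow U)" using assms by (rule bij_betw_Pow)
  moreover have "(`) f ` pairs U = pairs U"
  proof
    show "(`) f ` pairs U \<subseteq> pairs U"
      using assms by (auto simp: pairs_def bij_betw_def card_image inj_on_subset)
    show "pairs U \<subseteq> (`) f ` pairs U"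
    proof
      fix E assume E: "E \<in> pairs U"
      then have "E \<subseteq> f ` U" using assms by (auto simp: pairs_def bij_betw_def)
      then obtain D where D: "D \<subseteq> U" "E = f ` D" by (auto simp: subset_image_iff)
      then have "card D = 2"
        using E assms by (auto simp: pairs_def bij_betw_def card_image inj_on_subset)
      then show "E \<in> (`) f ` pairs U" using D by (auto simp: pairs_def)
    qed
  qed
  ultimately show ?thesis
    by (auto simp: bij_betw_def pairs_def intro: inj_on_subset)
qed

lemma pair_system_reflect: "pair_system {..<n} (\<lambda>x. (`) (reflect n x))"
  by (simp add: pair_system_def bij_betw_image_pairs bij_betw_reflect)

text \<open>Write \<open>E = {y, z}\<close>. Either \<open>y\<close> is sent to \<open>p\<close>,
  with at most three choices of \<open>x\<close> and \<open>n\<close> of \<open>z\<close>, or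
  \<open>z\<close> is sent to \<open>p\<close>, and then \<open>x\<close> determines
  \<open>z\<close>.\<close>

lemma card_loads_reflect_le: "card (loads {..<n} (\<lambda>x. (`) (reflect n x)) y p) \<le> 4 * n"
proof -
  \<comment> \<open>The solutions for \<open>x\<close> in \<open>reflect_cases\<close>; where one
    applies, its division is exact and its subtraction is not truncated.\<close>
  define X where "X = {(p + y - n) div 2, (p + y) div 2, (p + y + n) div 2}"
  let ?A = "(\<lambda>(x, z). (x, {y, z})) ` (X \<times> {..<n})"
  let ?B = "(\<lambda>x. (x, {y, reflect n x p})) ` {..<n}"
  have "loads {..<n} (\<lambda>x. (`) (reflect n x)) y p \<subseteq> ?A \<union> ?B"
  proof
    fix t assume "t \<in> loads {..<n} (\<lambda>x. (`) (reflect n x)) y p"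
    then obtain x E where t: "t = (x, E)" "x < n" and E: "E \<in> pairs ({..<n} - {x})"
      and y: "y \<in> E" and p: "p \<in> reflect n x ` E"
      by (auto simp: loads_def flags_def)
    from y obtain z where z: "E = {y, z}"
      using pairsD(2)[OF E] by (metis card_2_iff doubleton_eq_iff insert_iff singletonD)
    have yz: "y < n" "z < n" using E z by (auto simp: pairs_def)
    from p z consider "reflect n x y = p" | "reflect n x z = p" by auto
    then show "t \<in> ?A \<union> ?B"
    proof cases
      case 1
      then have "x \<in> X" using reflect_cases[OF t(2) yz(1)] by (auto simp: X_def)
      then show ?thesis using t z yz by auto
    next
      case 2
      then have "z = reflect n x p" using reflect_involution[OF t(2) yz(2)] by simp
      then show ?thesis using t z by auto
    qed
  qed
  then have "card (loads {..<n} (\<lambda>x. (`) (reflect n x)) y p) \<le> card (?A \<union> ?B)"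
    by (intro card_mono) (auto simp: X_def)
  also have "\<dots> \<le> card ?A + card ?B" by (rule card_Un_le)
  also have "\<dots> \<le> card (X \<times> {..<n}) + card {..<n}"
    by (intro add_mono card_image_le) (auto simp: X_def)
  also have "\<dots> = card X * n + n" by (simp add: card_cartesian_product)
  also have "\<dots> \<le> 3 * n + n"
    by (intro add_mono mult_mono) (auto simp: X_def card_insert_if)
  finally show ?thesis by simp
qed

section \<open>From a conflict-free pair system to a schedule\<close>

text \<open>Indexing games by their captain triples settles the second condition. For the first,
  \<open>T\<close> with captain \<open>x\<close> is a team of the game of \<open>insert x E\<close>
  exactly when \<open>\<phi> x E = T - {x}\<close>, and bijectivity of \<open>\<phi> x\<close> gives
  one such \<open>E\<close>.\<close>

lemma tryst_schedule_if_conflict_free: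
  assumes \<phi>: "pair_system V \<phi>" and clean: "conflicts V \<phi> = {}"
  shows "\<exists>S. tryst_schedule V S"
proof -
  define team where "team T x = (insert x (\<phi> x (T - {x})), x)" for T x
  define game where "game T = team T ` T" for T
  define triples where "triples = {T. T \<subseteq> V \<and> card T = 3}"
  have rest: "x \<in> V" "T - {x} \<in> pairs (V - {x})" if "T \<in> triples" "x \<in> T" for T x
    using that by (auto simp: triples_def pairs_def)
  have val: "\<phi> x (T - {x}) \<in> pairs (V - {x})" if "T \<in> triples" "x \<in> T" for T x
    using rest[OF that] by (rule pair_system_mem[OF \<phi>])
  have disj: "\<phi> x (T - {x}) \<inter> (T - {x}) = {}"
      "\<And>y. y \<in> T \<Longrightarrow> y \<noteq> x \<Longrightarrow> \<phi> x (T - {x}) \<inter> \<phi> y (T - {y}) = {}"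
    if T: "T \<in> triples" "x \<in> T" for T x
  proof -
    have "(x, T - {x}) \<notin> conflicts V \<phi>" using clean by simp
    moreover have "(x, T - {x}) \<in> flags V" using rest[OF T] by (simp add: flags_def)
    moreover have "insert x (T - {x}) = T" using T by auto
    ultimately have *: "\<phi> x (T - {x}) \<inter> (T - {x} \<union> (\<Union>y\<in>T - {x}. \<phi> y (T - {y}))) = {}"
      by (auto simp: conflicts_def)
    then show "\<phi> x (T - {x}) \<inter> (T - {x}) = {}" by blast
    show "\<phi> x (T - {x}) \<inter> \<phi> y (T - {y}) = {}" if "y \<in> T" "y \<noteq> x" for y using * that by blast
  qed
  have game: "tryst_game V (game T)" if T: "T \<in> triples" for T
    unfolding tryst_game_def
  proof (intro conjI ballI)
    have "inj_on (team T) T" by (rule inj_onI) (simp add: team_def)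
    then show "card (game T) = 3" using T by (simp add: game_def card_image triples_def)
    show "tryst_team t" "fst t \<subseteq> V" if t: "t \<in> game T" for t
    proof -
      obtain x where x: "x \<in> T" "t = team T x" using t by (auto simp: game_def)
      have "x \<notin> \<phi> x (T - {x})" using val[OF T x(1)] by (auto simp: pairs_def)
      then show "tryst_team t"
        using x pairsD[OF val[OF T x(1)]] by (simp add: tryst_team_def team_def)
      show "fst t \<subseteq> V" using x pairsD(1)[OF val[OF T x(1)]] rest(1)[OF T x(1)]
        by (auto simp: team_def)
    qed
    show "disjoint_family_on fst (game T)"
      unfolding disjoint_family_on_def
    proof (intro ballI impI)
      fix s t assume "s \<in> game T" "t \<in> game T" "s \<noteq> t"
      then obtain x y where xy: "x \<in> T" "y \<in> T" "x \<noteq> y" "s = team T x" "t = team T y"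
        by (auto simp: game_def)
      then show "fst s \<inter> fst t = {}"
        using disj[OF T xy(1)] disj(1)[OF T xy(2)] by (auto simp: team_def)
    qed
  qed
  \<comment> \<open>\<open>captains\<close> is a left inverse of \<open>game\<close>, so a game
    determines its index triple.\<close>
  have captains: "captains (game T) = T" for T
    by (auto simp: captains_def game_def team_def image_image)
  have "tryst_schedule V (game ` triples)"
    unfolding tryst_schedule_def
  proof (intro conjI allI impI ballI)
    show "tryst_game V g" if "g \<in> game ` triples" for g using that game by auto
  next
    fix T assume "T \<subseteq> V \<and> card T = 3"
    then have "T \<in> triples" by (simp add: triples_def)
    then show "\<exists>!g. g \<in> game ` triples \<and> captains g = T" using captains by auto
  next
    fix T x assume "T \<subseteq> V \<and> card T = 3" and x: "x \<in> T"
    then have T: "T \<in> triples" by (simp add: triples_def)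
    have bij: "bij_betw (\<phi> x) (pairs (V - {x})) (pairs (V - {x}))"
      using \<phi> rest(1)[OF T x] by (simp add: pair_system_def)
    then obtain E where E: "E \<in> pairs (V - {x})" "\<phi> x E = T - {x}"
      using rest(2)[OF T x] by (metis bij_betw_def imageE)
    have xE: "x \<notin> E" using E(1) by (auto simp: pairs_def)
    have "insert x E \<in> triples"
      using E xE rest(1)[OF T x] pairsD[OF E(1)] by (auto simp: triples_def)
    moreover have "(T, x) \<in> game (insert x E)"
    proof -
      have "team (insert x E) x = (T, x)" using E(2) xE x by (auto simp: team_def)
      then show ?thesis unfolding game_def by (metis image_eqI insertI1)
    qed
    \<comment> \<open>Uniqueness is injectivity of \<open>\<phi> x\<close>: both triples give the
      value \<open>T - {x}\<close>.\<close>
    moreover have "T' = insert x E" if T': "T' \<in> triples" "(T, x) \<in> game T'" for T'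
    proof -
      have xT': "x \<in> T'" and eq: "T = insert x (\<phi> x (T' - {x}))"
        using T'(2) by (auto simp: game_def team_def)
      have "x \<notin> \<phi> x (T' - {x})" using val[OF T'(1) xT'] by (auto simp: pairs_def)
      then have "\<phi> x (T' - {x}) = \<phi> x E" using eq E(2) by auto
      then have "T' - {x} = E"
        using bij rest(2)[OF T'(1) xT'] E(1) by (auto simp: bij_betw_def dest: inj_onD)
      then show ?thesis using xT' by auto
    qed
    ultimately show "\<exists>!g. g \<in> game ` triples \<and> (T, x) \<in> g" by blast
  qed
  then show ?thesis by blast
qed

theorem theorem1p10:
  "\<exists>n0::nat. \<forall>n\<ge>n0. tryst_table_solvable n"
proof (intro exI allI impI)
  fix n :: nat assume n: "400 \<le> n"
  define K where "K = n * n div 8"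
  have sq: "400 * n \<le> n * n" using n by simp
  have "8 * K \<le> n * n" "n * n < 8 * K + 8" unfolding K_def by linarith+
  \<comment> \<open>Rounding in \<open>K\<close> costs little:
    \<open>2 * (n * n) < 16 * K + 16\<close>, and \<open>K\<close> exceeds 16. The bound
    \<open>4 * n \<le> K\<close> admits the reflections as a starting point.\<close>
  then have "2 * (n * n) < 17 * K" "8 * K \<le> n * n" "4 * n \<le> K" using sq n by linarith+
  then have "\<exists>\<psi>. pair_system {..<n} \<psi> \<and> conflicts {..<n} \<psi> = {}"
    using n card_loads_reflect_le[of n]
    by (intro conflict_free_exists[OF _ _ _ _ pair_system_reflect, of n K])
      (auto intro: order_trans)
  then show "tryst_table_solvable n"
    using tryst_schedule_if_conflict_free unfolding tryst_table_solvable_def by blast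
qed

end
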